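(* Let $0<s<1$ and let $\Omega\subset\mathbb{R}^n$ be a bounded domain that is convex in the $x_n$-direction. Let $g:\mathbb{R}\to\mathbb{R}$ be Lipschitz continuous and $\eta:\Omega^c\to\mathbb{R}$ a function, where $\Omega^c=\mathbb{R}^n\setminus\Omega$. Assume that $u\in\mathcal{L}_{2s}\cap C^2(\Omega)$ is a solution of $$\begin{cases}(-\Delta)^s u(x)-\Delta u(x)=g(u(x)), & x\in\Omega,\\ u(x)=\eta(x), & x\in\Omega^c,\end{cases}$$ and satisfies the following exterior condition: for any three points $x=(x',x_n)$, $y=(x',y_n)$, $z=(x',z_n)$ on a line parallel to the $x_n$-axis with $y_n<x_n<z_n$ and $y,z\in\Omega^c$, one has $$\eta(y)<u(x)<\eta(z)\ \text{ if } x\in\Omega,\qquad \eta(y)\le\eta(x)\le\eta(z)\ \text{ if } x\in\Omega^c.$$ Then $u$ is strictly monotone increasing with respect to $x_n$ in $\Omega$, that is, for any $\tau>0$, $$u(x',x_n+\tau)>u(x',x_n)\quad\text{whenever } (x',x_n),(x',x_n+\tau)\in\Omega.$$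
   Context: Points of $\mathbb{R}^n$ are written $x=(x',x_n)$ with $x'\in\mathbb{R}^{n-1}$. $\Omega$ is convex in the $x_n$-direction if every segment parallel to the $x_n$-axis with endpoints in $\Omega$ is contained in $\Omega$. The space $\mathcal{L}_{2s}$ is $$\mathcal{L}_{2s}=\Big\{u\in L^1_{loc}(\mathbb{R}^n)\ \Big|\ \int_{\mathbb{R}^n}\frac{|u(x)|}{1+|x|^{n+2s}}\,dx<+\infty\Big\}.$$ The fractional Laplacian is $$(-\Delta)^s u(x)=C_{n,s}\,\mathrm{P.V.}\int_{\mathbb{R}^n}\frac{u(x)-u(y)}{|x-y|^{n+2s}}\,dy=C_{n,s}\lim_{\epsilon\to0}\int_{\mathbb{R}^n\setminus B_\epsilon(x)}\frac{u(x)-u(y)}{|x-y|^{n+2s}}\,dy,$$ where $C_{n,s}>0$ is the usual normalization constant. $\Delta$ is the classical Laplacian.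
   Formalization: The formal theorem also assumes that u is continuous on the closure of Ω (boundary values of η attained continuously from inside); without this the claim fails, e.g. for n=1, Ω=(-1,1), s=1/4, g=0, with a solution that jumps at the endpoints. *)

theory Defs
  imports "HOL-Analysis.Analysis"
begin

text \<open>
  Points of n-dimensional space are vectors of type \<open>real ^ 'n\<close>, with \<open>n = CARD('n)\<close>. The
  distinguished coordinate \<open>x\<^sub>n\<close> is the one with index \<open>k :: 'n\<close>, and \<open>x'\<close> is the family of
  all the others; \<open>k\<close> is arbitrary, since an index type carries no order that singles out a last
  index.
\<close>

definition same_line :: "'n \<Rightarrow> real ^ 'n \<Rightarrow> real ^ 'n \<Rightarrow> bool" where
  "same_line k x y \<longleftrightarrow> (\<forall>i. i \<noteq> k \<longrightarrow> x $ i = y $ i)"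

definition convex_in_direction :: "'n \<Rightarrow> (real ^ 'n) set \<Rightarrow> bool" where
  "convex_in_direction k S \<longleftrightarrow>
     (\<forall>x\<in>S. \<forall>y\<in>S. same_line k x y \<longrightarrow> closed_segment x y \<subseteq> S)"

definition partial_deriv :: "'n \<Rightarrow> (real ^ 'n \<Rightarrow> real) \<Rightarrow> real ^ 'n \<Rightarrow> real" where
  "partial_deriv i u x = deriv (\<lambda>t. u (x + t *\<^sub>R axis i 1)) 0"

text \<open>The next two notions are meant for open \<open>S\<close>.\<close>

definition C1_on :: "(real ^ 'n) set \<Rightarrow> (real ^ 'n \<Rightarrow> real) \<Rightarrow> bool" where
  "C1_on S u \<longleftrightarrow>
     continuous_on S u \<and>
     (\<forall>i. (\<forall>x\<in>S. (\<lambda>t. u (x + t *\<^sub>R axis i 1)) field_differentiable at 0)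
        \<and> continuous_on S (partial_deriv i u))"

definition C2_on :: "(real ^ 'n) set \<Rightarrow> (real ^ 'n \<Rightarrow> real) \<Rightarrow> bool" where
  "C2_on S u \<longleftrightarrow> C1_on S u \<and> (\<forall>i. C1_on S (partial_deriv i u))"

definition laplacian :: "(real ^ 'n \<Rightarrow> real) \<Rightarrow> real ^ 'n \<Rightarrow> real" where
  "laplacian u x = (\<Sum>i\<in>UNIV. partial_deriv i (partial_deriv i u) x)"

definition locally_integrable :: "(real ^ 'n \<Rightarrow> real) \<Rightarrow> bool" where
  "locally_integrable u \<longleftrightarrow> (\<forall>K. compact K \<longrightarrow> set_integrable lebesgue K u)"

definition L2s_space :: "real \<Rightarrow> (real ^ 'n \<Rightarrow> real) set" where
  "L2s_space s =
     {u. locally_integrable u \<and>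
         integrable lebesgue (\<lambda>x. \<bar>u x\<bar> / (1 + norm x powr (real CARD('n) + 2 * s)))}"

text \<open>
  The usual constant \<open>C\<^sub>n\<^sub>,\<^sub>s\<close>, for which the operator has Fourier symbol
  \<open>\<bar>\<xi>\<bar>\<^sup>2\<^sup>s\<close>.
\<close>

definition frac_lap_const :: "'n::finite itself \<Rightarrow> real \<Rightarrow> real" where
  "frac_lap_const _ s =
     4 powr s * Gamma (real CARD('n) / 2 + s)
       / (pi powr (real CARD('n) / 2) * \<bar>Gamma (- s)\<bar>)"

text \<open>
  \<open>has_fractional_laplacian s u x l\<close> says that the principal value defining the fractional
  Laplacian of order \<open>s\<close> of \<open>u\<close> at \<open>x\<close> exists and that the fractional Laplacian is \<open>l\<close> there.
\<close>

definition has_fractional_laplacian ::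
    "real \<Rightarrow> (real ^ 'n \<Rightarrow> real) \<Rightarrow> real ^ 'n \<Rightarrow> real \<Rightarrow> bool" where
  "has_fractional_laplacian s u x l \<longleftrightarrow>
     ((\<lambda>\<epsilon>. frac_lap_const TYPE('n) s *
          (LINT y:- ball x \<epsilon>|lebesgue.
             (u x - u y) / norm (x - y) powr (real CARD('n) + 2 * s)))
       \<longlongrightarrow> l) (at_right 0)"

end

theory Submission
  imports Defs
begin

text \<open>
  The proof is a sliding argument.  Write \<open>e\<close> for the unit vector of the direction \<open>k\<close> and
  \<open>w\<^sub>t y = u (y + t *\<^sub>R e) - u y\<close>.  The exterior condition gives \<open>w\<^sub>t \<ge> 0\<close> as soon as one of the two
  points is outside \<open>\<Omega>\<close>, and \<open>w\<^sub>t > 0\<close> on the set \<open>P\<^sub>t\<close> of points of \<open>\<Omega>\<close> that the shift moves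
  out of \<open>\<Omega>\<close> (\<open>exterior_monotone\<close>).  The set \<open>P\<^sub>t\<close> has positive measure, because countably many
  translates of it cover \<open>\<Omega>\<close> (\<open>not_negligible_translation_loss\<close>).

  The analytic input is an estimate at a global minimum \<open>x\<close> of \<open>w\<^sub>t\<close> with \<open>w\<^sub>t x = - m \<le> 0\<close>.  There the
  Laplacian of \<open>w\<^sub>t\<close> is nonnegative, and the difference of the two equations together with the
  Lipschitz bound on \<open>g\<close> shows that the integral of the nonnegative function
  \<open>(w\<^sub>t y + m) / norm (x - y) powr (n + 2 * s)\<close> is at most a fixed multiple of \<open>m\<close>
  (\<open>nn_integral_kernel_of_shift_at_minimum\<close>).  A shallow minimum thus forces \<open>w\<^sub>t\<close> to be small
  in the mean, in contrast to its positivity on \<open>P\<^sub>t\<close>.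

  Suppose that \<open>w\<^sub>t\<close> is negative somewhere for some \<open>t > 0\<close>, and let \<open>\<sigma>\<close> be the supremum of such \<open>t\<close>;
  it is finite because \<open>\<Omega>\<close> is bounded.  By continuity \<open>w\<^sub>\<sigma> \<ge> 0\<close>, and there are shifts \<open>t\<^sub>j < \<sigma>\<close> tending
  to \<open>\<sigma>\<close> with negative minima.  By compactness of the closure of \<open>\<Omega>\<close> the depths of these
  minima tend to the depth of \<open>w\<^sub>\<sigma>\<close> at a limit point, hence to \<open>0\<close>.  On the fixed set \<open>P\<^sub>\<sigma>\<close> the
  functions \<open>w\<close> for the shifts \<open>t\<^sub>j\<close> are eventually bounded below by a positive number, pointwise
  (\<open>eventual_gain_before_exit\<close>).  Fatou's lemma then makes \<open>P\<^sub>\<sigma>\<close> negligible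
  (\<open>negligible_if_kernel_mass_vanishes\<close>), which is absurd.  Passing to the limit inside the integral
  takes the place of a maximum principle for narrow domains.  So \<open>w\<^sub>t \<ge> 0\<close> for all \<open>t > 0\<close>, and a
  zero of \<open>w\<^sub>t\<close> at a pair of points of \<open>\<Omega>\<close> is excluded by the same estimate with \<open>m = 0\<close>.
\<close>

section \<open>Integrability of the kernel and translation invariance\<close>

lemma dyadic_scale_exists:
  fixes r \<epsilon> :: real
  assumes "0 < \<epsilon>" "\<epsilon> \<le> r"
  obtains j where "2 ^ j * \<epsilon> \<le> r" "r < 2 ^ Suc j * \<epsilon>"
proof -
  obtain n where n: "r / \<epsilon> < 2 ^ n"
    using real_arch_pow[of 2 "r / \<epsilon>"] by auto
  define N where "N = (LEAST n. r / \<epsilon> < 2 ^ n)"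
  have N: "r / \<epsilon> < 2 ^ N" unfolding N_def using n by (rule LeastI)
  moreover have "N \<noteq> 0"
    using N assms by (intro notI) (simp add: field_simps)
  then obtain j where j: "N = Suc j" by (cases N) auto
  moreover have "\<not> r / \<epsilon> < 2 ^ j"
    using not_less_Least[of j "\<lambda>n. r / \<epsilon> < 2 ^ n"] j by (simp add: N_def)
  ultimately show thesis
    using assms by (intro that[of j]) (auto simp: field_simps)
qed

text \<open>
  Cut the exterior of the ball into the dyadic shells \<open>2 ^ j * \<epsilon> \<le> norm (x - y) < 2 ^ Suc j * \<epsilon>\<close>.
  On the shell of index \<open>j\<close> the integrand is at most \<open>(2 ^ j * \<epsilon>) powr (- p)\<close>, and the shell lies
  in a ball of volume proportional to \<open>(2 ^ j * \<epsilon>) ^ DIM('a)\<close>; for \<open>p > DIM('a)\<close> the products form a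
  convergent geometric series.
\<close>

lemma set_integrable_norm_powr_outside_ball:
  fixes x :: "'a::euclidean_space"
  assumes p: "p > real DIM('a)" and \<epsilon>: "0 < \<epsilon>"
  shows "set_integrable lebesgue (- ball x \<epsilon>) (\<lambda>y. 1 / norm (x - y) powr p)"
proof -
  let ?V = "unit_ball_vol (real DIM('a))"
  let ?a = "\<lambda>j::nat. (2 ^ j * \<epsilon>) powr (- p)"
  let ?f = "\<lambda>y. indicator (- ball x \<epsilon>) y *\<^sub>R (1 / norm (x - y) powr p)"
  let ?q = "2 powr (real DIM('a) - p)"
  have bound: "ennreal (norm (?f y)) \<le>
      (\<Sum>j. ennreal (?a j) * indicator (ball x (2 ^ Suc j * \<epsilon>)) y)" for y
  proof (cases "y \<in> ball x \<epsilon>")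
    case False
    then have "\<epsilon> \<le> norm (x - y)" by (simp add: dist_norm)
    then obtain j where j: "2 ^ j * \<epsilon> \<le> norm (x - y)" "norm (x - y) < 2 ^ Suc j * \<epsilon>"
      using \<epsilon> dyadic_scale_exists by blast
    have "norm (?f y) = norm (x - y) powr (- p)"
      using False by (simp add: powr_minus_divide)
    also have "\<dots> \<le> ?a j"
      using j(1) \<epsilon> p by (intro powr_mono2') auto
    finally have "ennreal (norm (?f y)) \<le> ennreal (?a j) * indicator (ball x (2 ^ Suc j * \<epsilon>)) y"
      using j(2) by (simp add: dist_norm ennreal_leI)
    also have "\<dots> \<le> (\<Sum>j. ennreal (?a j) * indicator (ball x (2 ^ Suc j * \<epsilon>)) y)"
      using sum_le_suminf[OF summableI, of "{j}" "\<lambda>j. ennreal (?a j) * indicator (ball x (2 ^ Suc j * \<epsilon>)) y"]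
      by (simp del: sum_ennreal sum_mult_indicator indicator_simps)
    finally show ?thesis .
  qed simp
  have shell: "?a j * (?V * (2 ^ Suc j * \<epsilon>) ^ DIM('a))
      = (?V * 2 ^ DIM('a) * \<epsilon> powr (real DIM('a) - p)) * ?q ^ j" for j
  proof -
    have "?a j * (2 ^ j * \<epsilon>) ^ DIM('a) = (2 ^ j * \<epsilon>) powr (real DIM('a) - p)"
      using \<epsilon> by (simp add: powr_diff powr_minus_divide powr_realpow)
    also have "\<dots> = ?q ^ j * \<epsilon> powr (real DIM('a) - p)"
      using \<epsilon> by (simp add: powr_mult powr_powr powr_realpow[symmetric] mult.commute)
    finally show ?thesis
      by (simp add: power_mult_distrib mult_ac)
  qed
  have "(\<integral>\<^sup>+y. ennreal (norm (?f y)) \<partial>lebesgue)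
      \<le> (\<integral>\<^sup>+y. (\<Sum>j. ennreal (?a j) * indicator (ball x (2 ^ Suc j * \<epsilon>)) y) \<partial>lebesgue)"
    by (intro nn_integral_mono bound)
  also have "\<dots> = (\<Sum>j. ennreal (?a j) * emeasure lborel (ball x (2 ^ Suc j * \<epsilon>)))"
    by (subst nn_integral_suminf)
      (simp_all add: nn_integral_cmult_indicator borel_measurable_times_ennreal
        borel_measurable_indicator del: power_Suc sum_mult_indicator)
  also have "\<dots> = (\<Sum>j. ennreal ((?V * 2 ^ DIM('a) * \<epsilon> powr (real DIM('a) - p)) * ?q ^ j))"
  proof (rule arg_cong[where f = suminf], rule ext)
    fix j
    have "ennreal (?a j) * emeasure lborel (ball x (2 ^ Suc j * \<epsilon>))
        = ennreal (?a j * (?V * (2 ^ Suc j * \<epsilon>) ^ DIM('a)))"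
      using \<epsilon> by (subst emeasure_ball) (simp_all add: ennreal_mult' del: power_Suc)
    then show "ennreal (?a j) * emeasure lborel (ball x (2 ^ Suc j * \<epsilon>))
        = ennreal ((?V * 2 ^ DIM('a) * \<epsilon> powr (real DIM('a) - p)) * ?q ^ j)"
      by (simp only: shell)
  qed
  also have "\<dots> < \<infinity>"
  proof -
    have "?q < 1" using p by (simp add: powr_less_one)
    then have "summable (\<lambda>j. (?V * 2 ^ DIM('a) * \<epsilon> powr (real DIM('a) - p)) * ?q ^ j)"
      by (intro summable_mult summable_geometric) simp
    then show ?thesis
      by (subst suminf_ennreal2) auto
  qed
  finally have fin: "(\<integral>\<^sup>+y. ennreal (norm (?f y)) \<partial>lebesgue) < \<infinity>" .
  have "?f \<in> borel_measurable borel" by measurable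
  then have "?f \<in> borel_measurable lebesgue" by (simp add: measurable_completion)
  then show ?thesis
    unfolding set_integrable_def using fin by (rule integrableI_bounded)
qed

lemma lebesgue_distr_translation:
  fixes a :: "'a::euclidean_space"
  shows "distr lebesgue lebesgue (\<lambda>x. x + a) = lebesgue"
    and measurable_lebesgue_translation: "(\<lambda>x. x + a) \<in> lebesgue \<rightarrow>\<^sub>M lebesgue"
proof -
  have T: "(\<lambda>x. a + (\<Sum>j\<in>Basis. (1 * (x \<bullet> j)) *\<^sub>R j)) = (\<lambda>x. x + a)"
    by (simp add: euclidean_representation add.commute)
  show "(\<lambda>x. x + a) \<in> lebesgue \<rightarrow>\<^sub>M lebesgue"
    using lebesgue_affine_measurable[of "\<lambda>_. 1" a] unfolding T by simp
  show "distr lebesgue lebesgue (\<lambda>x. x + a) = lebesgue"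
    using lebesgue_affine_euclidean[of "\<lambda>_. 1" a] unfolding T by (simp add: density_1)
qed

text \<open>
  The weighted integrability in the definition of the space controls only \<open>\<bar>u\<bar>\<close>, so measurability
  of \<open>u\<close> itself is drawn from local integrability: \<open>u\<close> is the pointwise limit of its truncations
  to growing balls.
\<close>

lemma L2s_space_borel_measurable:
  fixes u :: "real ^ 'n \<Rightarrow> real"
  assumes "u \<in> L2s_space s"
  shows "u \<in> borel_measurable lebesgue"
proof (rule borel_measurable_LIMSEQ_real)
  fix x :: "real ^ 'n"
  obtain N where N: "norm x \<le> real N" using real_arch_simple by blast
  have "(\<lambda>m. indicator (cball 0 (real m)) x *\<^sub>R u x) \<longlonglongrightarrow> u x"
  proof (rule tendsto_eventually, rule eventually_sequentiallyI)
    fix m assume "m \<ge> N"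
    then have "norm x \<le> real m" using N by linarith
    then show "indicator (cball 0 (real m)) x *\<^sub>R u x = u x" by simp
  qed
  then show "(\<lambda>m. indicator (cball 0 (real m)) x *\<^sub>R u x) \<longlonglongrightarrow> u x" .
next
  show "(\<lambda>x. indicator (cball 0 (real m)) x *\<^sub>R u x) \<in> borel_measurable lebesgue" for m
    using assms unfolding L2s_space_def locally_integrable_def set_integrable_def
    by (auto intro: borel_measurable_integrable)
qed

definition frac_kernel :: "real \<Rightarrow> (real ^ 'n \<Rightarrow> real) \<Rightarrow> real ^ 'n \<Rightarrow> real ^ 'n \<Rightarrow> real" where
  "frac_kernel s u x y = (u x - u y) / norm (x - y) powr (real CARD('n) + 2 * s)"

text \<open>
  Off the ball, \<open>1 + norm y powr p \<le> K * norm (x - y) powr p\<close> for a constant \<open>K\<close> depending on \<open>x\<close>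
  and \<open>\<epsilon>\<close>, so the term with \<open>u y\<close> is dominated by the weight that defines the function space; the
  constant term \<open>u x\<close> is integrable against the kernel by the dyadic estimate.  Without this
  integrability the Bochner integrals in the principal value would not be additive in \<open>u\<close>.
\<close>

lemma set_integrable_frac_kernel:
  fixes u :: "real ^ 'n \<Rightarrow> real"
  assumes u: "u \<in> L2s_space s" and s: "0 < s" and \<epsilon>: "0 < \<epsilon>"
  shows "set_integrable lebesgue (- ball x \<epsilon>) (frac_kernel s u x)"
proof -
  define p where "p = real CARD('n) + 2 * s"
  have p: "p > 0" "p > real DIM(real ^ 'n)" using s by (simp_all add: p_def)
  define K where "K = (1 / \<epsilon>) powr p + (norm x / \<epsilon> + 1) powr p"
  have [measurable]: "u \<in> borel_measurable lebesgue"
    using u by (rule L2s_space_borel_measurable)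
  have [measurable]: "(\<lambda>y. norm (x - y) powr p) \<in> borel_measurable lebesgue"
    by (rule measurable_completion) measurable
  have one: "set_integrable lebesgue (- ball x \<epsilon>) (\<lambda>y. 1 / norm (x - y) powr p)"
    using p \<epsilon> by (intro set_integrable_norm_powr_outside_ball)
  have two: "set_integrable lebesgue (- ball x \<epsilon>) (\<lambda>y. u y / norm (x - y) powr p)"
    unfolding set_integrable_def
  proof (rule Bochner_Integration.integrable_bound)
    show "integrable lebesgue (\<lambda>y. K * (\<bar>u y\<bar> / (1 + norm y powr p)))"
      using u unfolding L2s_space_def p_def by (intro integrable_mult_right) simp
    show "(\<lambda>y. indicator (- ball x \<epsilon>) y *\<^sub>R (u y / norm (x - y) powr p))
        \<in> borel_measurable lebesgue"
      by (intro borel_measurable_scaleR borel_measurable_indicator borel_measurable_divide)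
        (auto intro!: lmeasurable_ball)
    show "AE y in lebesgue. norm (indicator (- ball x \<epsilon>) y *\<^sub>R (u y / norm (x - y) powr p))
        \<le> norm (K * (\<bar>u y\<bar> / (1 + norm y powr p)))"
    proof (rule AE_I2)
      fix y
      have K0: "K \<ge> 0" by (simp add: K_def)
      show "norm (indicator (- ball x \<epsilon>) y *\<^sub>R (u y / norm (x - y) powr p))
          \<le> norm (K * (\<bar>u y\<bar> / (1 + norm y powr p)))"
      proof (cases "y \<in> ball x \<epsilon>")
        case False
        define d where "d = norm (x - y)"
        have d: "\<epsilon> \<le> d" "d > 0" using False \<epsilon> by (auto simp: d_def dist_norm)
        have "1 \<le> (1 / \<epsilon> * d) powr p"
          using d \<epsilon> p by (intro ge_one_powr_ge_zero) (auto simp: field_simps)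
        moreover have "norm y powr p \<le> ((norm x / \<epsilon> + 1) * d) powr p"
        proof (rule powr_mono2)
          have "norm y \<le> norm x + d"
            unfolding d_def using norm_triangle_sub[of y x] by (simp add: norm_minus_commute)
          also have "norm x \<le> norm x / \<epsilon> * d"
            using d \<epsilon> mult_right_mono[of \<epsilon> d "norm x"] by (simp add: field_simps)
          finally show "norm y \<le> (norm x / \<epsilon> + 1) * d" by (simp add: algebra_simps)
        qed (use p in auto)
        ultimately have "1 + norm y powr p \<le> K * d powr p"
          using d \<epsilon> powr_mult[of "1 / \<epsilon>" d p] powr_mult[of "norm x / \<epsilon> + 1" d p]
          unfolding K_def distrib_right[of _ _ "d powr p"] by (simp del: times_divide_eq_left)
        then have "1 / d powr p \<le> K / (1 + norm y powr p)"
          using d by (simp add: field_simps add_pos_nonneg)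
        then have "\<bar>u y\<bar> * (1 / d powr p) \<le> \<bar>u y\<bar> * (K / (1 + norm y powr p))"
          by (rule mult_left_mono) simp
        then show ?thesis
          using False K0 by (simp add: d_def[symmetric] abs_mult mult.commute)
      qed (use K0 in simp)
    qed
  qed
  have "set_integrable lebesgue (- ball x \<epsilon>)
      (\<lambda>y. u x * (1 / norm (x - y) powr p) - u y / norm (x - y) powr p)"
    using one two by (intro set_integral_diff(1) set_integrable_mult_right) auto
  moreover have "frac_kernel s u x =
      (\<lambda>y. u x * (1 / norm (x - y) powr p) - u y / norm (x - y) powr p)"
    by (simp add: fun_eq_iff frac_kernel_def p_def diff_divide_distrib)
  ultimately show ?thesis by simp
qed

lemma set_integrable_translation:
  fixes f :: "'a::euclidean_space \<Rightarrow> real"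
  assumes "set_integrable lebesgue A f"
  shows "set_integrable lebesgue {y. y + a \<in> A} (\<lambda>y. f (y + a))"
    and "(LINT y:{y. y + a \<in> A}|lebesgue. f (y + a)) = (LINT y:A|lebesgue. f y)"
proof -
  let ?h = "\<lambda>y. indicator A y *\<^sub>R f y"
  have eq: "(\<lambda>y. indicator {y. y + a \<in> A} y *\<^sub>R f (y + a)) = (\<lambda>y. ?h (y + a))"
    by (simp add: fun_eq_iff indicator_def)
  have h: "integrable lebesgue ?h" using assms by (simp add: set_integrable_def)
  then have "integrable (distr lebesgue lebesgue (\<lambda>y. y + a)) ?h"
    by (simp add: lebesgue_distr_translation)
  then show "set_integrable lebesgue {y. y + a \<in> A} (\<lambda>y. f (y + a))"
    unfolding set_integrable_def eq
    by (rule integrable_distr[OF measurable_lebesgue_translation])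
  have "(\<integral>y. ?h y \<partial>distr lebesgue lebesgue (\<lambda>y. y + a)) = (\<integral>y. ?h (y + a) \<partial>lebesgue)"
    using h by (intro integral_distr measurable_lebesgue_translation borel_measurable_integrable)
  then show "(LINT y:{y. y + a \<in> A}|lebesgue. f (y + a)) = (LINT y:A|lebesgue. f y)"
    unfolding set_lebesgue_integral_def eq lebesgue_distr_translation by simp
qed

lemma frac_kernel_translation:
  "frac_kernel s (\<lambda>y. u (y + a)) x y = frac_kernel s u (x + a) (y + a)"
  by (simp add: frac_kernel_def)

lemma translate_outside_ball:
  fixes a :: "'a::real_normed_vector"
  shows "{y. y + a \<in> - ball (x + a) \<epsilon>} = - ball x \<epsilon>"
  by (auto simp: dist_norm)

lemma set_integrable_frac_kernel_translation:
  fixes u :: "real ^ 'n \<Rightarrow> real"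
  assumes "u \<in> L2s_space s" "0 < s" "0 < \<epsilon>"
  shows "set_integrable lebesgue (- ball x \<epsilon>) (frac_kernel s (\<lambda>y. u (y + a)) x)"
  using set_integrable_translation(1)[OF set_integrable_frac_kernel[OF assms, of "x + a"], of a]
  by (simp add: translate_outside_ball frac_kernel_translation[symmetric] del: Compl_iff)

lemma has_fractional_laplacian_alt:
  fixes u :: "real ^ 'n \<Rightarrow> real"
  shows "has_fractional_laplacian s u x l \<longleftrightarrow>
    ((\<lambda>\<epsilon>. frac_lap_const TYPE('n) s * (LINT y:- ball x \<epsilon>|lebesgue. frac_kernel s u x y))
      \<longlongrightarrow> l) (at_right 0)"
  by (simp add: has_fractional_laplacian_def frac_kernel_def)

lemma has_fractional_laplacian_translation:
  fixes u :: "real ^ 'n \<Rightarrow> real"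
  assumes u: "u \<in> L2s_space s" and s: "0 < s" and l: "has_fractional_laplacian s u (x + a) l"
  shows "has_fractional_laplacian s (\<lambda>y. u (y + a)) x l"
  unfolding has_fractional_laplacian_alt
proof (rule Lim_transform_eventually[OF l[unfolded has_fractional_laplacian_alt]])
  show "\<forall>\<^sub>F \<epsilon> in at_right 0.
      frac_lap_const TYPE('n) s * (LINT y:- ball (x + a) \<epsilon>|lebesgue. frac_kernel s u (x + a) y) =
      frac_lap_const TYPE('n) s * (LINT y:- ball x \<epsilon>|lebesgue. frac_kernel s (\<lambda>y. u (y + a)) x y)"
    using eventually_at_right_less[of 0]
  proof eventually_elim
    case (elim \<epsilon>)
    show ?case
      using set_integrable_translation(2)[OF set_integrable_frac_kernel[OF u s elim, of "x + a"], of a]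
      by (simp only: translate_outside_ball frac_kernel_translation)
  qed
qed

lemma frac_kernel_diff:
  "frac_kernel s (\<lambda>y. u y - v y) x y = frac_kernel s u x y - frac_kernel s v x y"
  by (simp add: frac_kernel_def diff_divide_distrib[symmetric])

lemma has_fractional_laplacian_diff:
  fixes u v :: "real ^ 'n \<Rightarrow> real"
  assumes l: "has_fractional_laplacian s u x l" and m: "has_fractional_laplacian s v x m"
    and u: "\<And>\<epsilon>. 0 < \<epsilon> \<Longrightarrow> set_integrable lebesgue (- ball x \<epsilon>) (frac_kernel s u x)"
    and v: "\<And>\<epsilon>. 0 < \<epsilon> \<Longrightarrow> set_integrable lebesgue (- ball x \<epsilon>) (frac_kernel s v x)"
  shows "has_fractional_laplacian s (\<lambda>y. u y - v y) x (l - m)"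
  unfolding has_fractional_laplacian_alt
proof (rule Lim_transform_eventually)
  show "((\<lambda>\<epsilon>. frac_lap_const TYPE('n) s * (LINT y:- ball x \<epsilon>|lebesgue. frac_kernel s u x y)
      - frac_lap_const TYPE('n) s * (LINT y:- ball x \<epsilon>|lebesgue. frac_kernel s v x y))
      \<longlongrightarrow> l - m) (at_right 0)"
    using l m unfolding has_fractional_laplacian_alt by (rule tendsto_diff)
  show "\<forall>\<^sub>F \<epsilon> in at_right 0.
      frac_lap_const TYPE('n) s * (LINT y:- ball x \<epsilon>|lebesgue. frac_kernel s u x y)
      - frac_lap_const TYPE('n) s * (LINT y:- ball x \<epsilon>|lebesgue. frac_kernel s v x y)
      = frac_lap_const TYPE('n) s *
        (LINT y:- ball x \<epsilon>|lebesgue. frac_kernel s (\<lambda>y. u y - v y) x y)"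
    using eventually_at_right_less[of 0]
    by eventually_elim (simp add: frac_kernel_diff set_integral_diff(2) u v right_diff_distrib)
qed

text \<open>
  \<open>Gamma\<close> is never zero except at its poles, where it has the default value \<open>0\<close>; the range of \<open>s\<close> keeps
  \<open>- s\<close> away from them.
\<close>

lemma frac_lap_const_pos:
  assumes "0 < s" "s < 1"
  shows "frac_lap_const TYPE('n::finite) s > 0"
proof -
  have "- s \<notin> \<int>\<^sub>\<le>\<^sub>0"
  proof
    assume "- s \<in> \<int>\<^sub>\<le>\<^sub>0"
    then obtain m where m: "- s = real_of_int m" by (auto elim: nonpos_Ints_cases)
    then have "- 1 < m" "m < 0" using assms by linarith+
    then show False by simp
  qed
  then have "Gamma (- s) \<noteq> 0" by (simp add: Gamma_eq_zero_iff)
  then show ?thesis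
    unfolding frac_lap_const_def using assms
    by (intro divide_pos_pos mult_pos_pos Gamma_real_pos) auto
qed

section \<open>The nonlocal and the local operator at a minimum\<close>

text \<open>
  At a global minimum the integrand of the principal value has a constant sign, so the limit over
  shrinking balls can be replaced by an integral over the whole space: Fatou's lemma, applied along
  \<open>\<epsilon> = 1 / Suc m\<close>, bounds that integral by the limit of the truncated ones.  The value
  of \<open>frac_kernel\<close> at \<open>y = x\<close> is \<open>0 / 0 = 0\<close>, so the diagonal needs no exception.
\<close>

lemma nn_integral_frac_kernel_at_minimum:
  fixes w :: "real ^ 'n \<Rightarrow> real"
  assumes s: "0 < s" "s < 1"
    and l: "has_fractional_laplacian s w x l"
    and int: "\<And>\<epsilon>. 0 < \<epsilon> \<Longrightarrow> set_integrable lebesgue (- ball x \<epsilon>) (frac_kernel s w x)"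
    and min: "\<And>y. w x \<le> w y"
  shows "(\<integral>\<^sup>+y. ennreal (- frac_kernel s w x y) \<partial>lebesgue)
    \<le> ennreal (- l / frac_lap_const TYPE('n) s)"
proof -
  define C where "C = frac_lap_const TYPE('n) s"
  have C: "C > 0" unfolding C_def using s by (rule frac_lap_const_pos)
  define \<epsilon> where "\<epsilon> m = 1 / real (Suc m)" for m
  have \<epsilon>: "0 < \<epsilon> m" for m by (simp add: \<epsilon>_def)
  have \<epsilon>_lim: "\<epsilon> \<longlonglongrightarrow> 0" unfolding \<epsilon>_def by (rule LIMSEQ_Suc[OF lim_1_over_n])
  define I where "I m = (LINT y:- ball x (\<epsilon> m)|lebesgue. frac_kernel s w x y)" for m
  define f where "f m y = indicator (- ball x (\<epsilon> m)) y *\<^sub>R (- frac_kernel s w x y)" for m y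
  have "filterlim \<epsilon> (at_right 0) sequentially"
    using \<epsilon> \<epsilon>_lim by (intro tendsto_imp_filterlim_at_right) auto
  then have "(\<lambda>m. C * I m) \<longlonglongrightarrow> l"
    using l unfolding has_fractional_laplacian_alt C_def I_def by (rule filterlim_compose[rotated])
  then have "(\<lambda>m. - (C * I m) / C) \<longlonglongrightarrow> - l / C"
    using C by (intro tendsto_intros) auto
  then have I_lim: "(\<lambda>m. ennreal (- I m)) \<longlonglongrightarrow> ennreal (- l / C)"
    using C by (intro tendsto_ennrealI) simp
  have kernel_nonpos: "frac_kernel s w x y \<le> 0" for y
    using min[of y] by (simp add: frac_kernel_def divide_nonpos_nonneg)
  have f_int: "integrable lebesgue (f m)" for m
    using int[OF \<epsilon>[of m]] by (simp add: f_def[abs_def] set_integrable_def)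
  have f_integral: "(\<integral>\<^sup>+y. ennreal (f m y) \<partial>lebesgue) = ennreal (- I m)" for m
  proof -
    have "(\<integral>\<^sup>+y. ennreal (f m y) \<partial>lebesgue) = ennreal (\<integral>y. f m y \<partial>lebesgue)"
      using f_int by (rule nn_integral_eq_integral) (auto simp: f_def kernel_nonpos indicator_def)
    also have "(\<integral>y. f m y \<partial>lebesgue) = - I m"
      by (simp add: f_def I_def set_lebesgue_integral_def)
    finally show ?thesis .
  qed
  have f_lim: "(\<lambda>m. ennreal (f m y)) \<longlonglongrightarrow> ennreal (- frac_kernel s w x y)" for y
  proof (cases "y = x")
    case True
    then show ?thesis by (simp add: f_def frac_kernel_def)
  next
    case False
    then have "\<forall>\<^sub>F m in sequentially. \<epsilon> m < dist x y"
      using order_tendstoD(2)[OF \<epsilon>_lim, of "dist x y"] by simp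
    then show ?thesis
      by (intro tendsto_eventually, eventually_elim) (simp add: f_def)
  qed
  have "(\<integral>\<^sup>+y. ennreal (- frac_kernel s w x y) \<partial>lebesgue)
      = (\<integral>\<^sup>+y. liminf (\<lambda>m. ennreal (f m y)) \<partial>lebesgue)"
    by (intro nn_integral_cong lim_imp_Liminf[symmetric] f_lim) simp
  also have "\<dots> \<le> liminf (\<lambda>m. \<integral>\<^sup>+y. ennreal (f m y) \<partial>lebesgue)"
    using f_int by (intro nn_integral_liminf) (auto intro: borel_measurable_integrable)
  also have "\<dots> = ennreal (- l / C)"
    unfolding f_integral using I_lim by (simp add: lim_imp_Liminf)
  finally show ?thesis by (simp add: C_def)
qed

text \<open>
  Since \<open>\<phi>'\<close> vanishes at the minimum, \<open>D < 0\<close> would make \<open>\<phi>'\<close> negative just to the right of \<open>0\<close>,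
  and \<open>\<phi>\<close> would drop below its minimum there.
\<close>

lemma second_derivative_nonneg_at_minimum:
  fixes \<phi> \<phi>' :: "real \<Rightarrow> real"
  assumes d: "0 < d"
    and deriv: "\<And>t. \<bar>t\<bar> < d \<Longrightarrow> (\<phi> has_real_derivative \<phi>' t) (at t)"
    and deriv2: "(\<phi>' has_real_derivative D) (at 0)"
    and min: "\<And>t. \<phi> 0 \<le> \<phi> t"
  shows "0 \<le> D"
proof (rule ccontr)
  assume "\<not> 0 \<le> D"
  then obtain e where e: "e > 0" "\<And>h. 0 < h \<Longrightarrow> h < e \<Longrightarrow> \<phi>' (0 + h) < \<phi>' 0"
    using DERIV_neg_dec_right[OF deriv2] by auto
  have "\<phi>' 0 = 0"
    using DERIV_local_min[OF deriv[of 0] d] d min by simp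
  define h where "h = min d e / 2"
  have h: "0 < h" "h < d" "h < e" using d e by (auto simp: h_def)
  have "\<phi> h < \<phi> 0"
  proof (rule DERIV_neg_imp_decreasing_open[OF h(1)])
    show "\<exists>y. (\<phi> has_real_derivative y) (at t) \<and> y < 0" if "0 < t" "t < h" for t
      using deriv[of t] e(2)[of t] that h \<open>\<phi>' 0 = 0\<close> by auto
    show "continuous_on {0..h} \<phi>"
    proof (rule continuous_at_imp_continuous_on, rule ballI)
      fix t assume "t \<in> {0..h}"
      then have "\<bar>t\<bar> < d" using h by auto
      then show "isCont \<phi> t" by (rule DERIV_isCont[OF deriv])
    qed
  qed
  with min[of h] show False by simp
qed

text \<open>
  \<open>partial_deriv\<close> is a derivative at the parameter \<open>0\<close> of a line through a moving base point.
  This lemma turns it into the derivative at every small parameter \<open>t\<close> of one fixed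
  restriction to a line, which is the form that one-variable calculus takes.
\<close>

lemma C2_on_axis_derivatives:
  fixes u :: "real ^ 'n \<Rightarrow> real"
  assumes u: "C2_on S u" and S: "open S" "x \<in> S"
  obtains d where "0 < d"
    "\<And>t. \<bar>t\<bar> < d \<Longrightarrow>
      ((\<lambda>t. u (x + t *\<^sub>R axis i 1)) has_real_derivative partial_deriv i u (x + t *\<^sub>R axis i 1)) (at t)"
    "((\<lambda>t. partial_deriv i u (x + t *\<^sub>R axis i 1))
      has_real_derivative partial_deriv i (partial_deriv i u) x) (at 0)"
proof -
  obtain d where d: "0 < d" "ball x d \<subseteq> S"
    using S open_contains_ball by blast
  show thesis
  proof (rule that[OF d(1)])
    fix t :: real assume t: "\<bar>t\<bar> < d"
    let ?y = "x + t *\<^sub>R axis i 1"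
    have "?y \<in> S" using d(2) t by (intro subsetD[OF d(2)]) (simp add: dist_norm)
    then have "((\<lambda>r. u (?y + r *\<^sub>R axis i 1)) has_real_derivative partial_deriv i u ?y) (at 0)"
      using u unfolding C2_on_def C1_on_def partial_deriv_def
      by (auto simp: DERIV_deriv_iff_field_differentiable)
    then show "((\<lambda>t. u (x + t *\<^sub>R axis i 1)) has_real_derivative partial_deriv i u ?y) (at t)"
      using DERIV_shift[of "\<lambda>t. u (x + t *\<^sub>R axis i 1)" _ 0 t]
      by (simp add: scaleR_add_left add_ac)
  next
    show "((\<lambda>t. partial_deriv i u (x + t *\<^sub>R axis i 1))
      has_real_derivative partial_deriv i (partial_deriv i u) x) (at 0)"
      using u S(2) unfolding C2_on_def C1_on_def partial_deriv_def[of i "partial_deriv i u"]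
      by (auto simp: DERIV_deriv_iff_field_differentiable)
  qed
qed

lemma laplacian_le_translate_at_minimum:
  fixes u :: "real ^ 'n \<Rightarrow> real"
  assumes u: "C2_on S u" and S: "open S" "x \<in> S" "x + a \<in> S"
    and min: "\<And>y. u (x + a) - u x \<le> u (y + a) - u y"
  shows "laplacian u x \<le> laplacian u (x + a)"
  unfolding laplacian_def
proof (rule sum_mono)
  fix i :: 'n
  obtain d where d: "0 < d"
    "\<And>t. \<bar>t\<bar> < d \<Longrightarrow>
      ((\<lambda>t. u (x + t *\<^sub>R axis i 1)) has_real_derivative partial_deriv i u (x + t *\<^sub>R axis i 1)) (at t)"
    "((\<lambda>t. partial_deriv i u (x + t *\<^sub>R axis i 1))
      has_real_derivative partial_deriv i (partial_deriv i u) x) (at 0)"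
    using C2_on_axis_derivatives[OF u S(1,2)] by blast
  obtain d' where d': "0 < d'"
    "\<And>t. \<bar>t\<bar> < d' \<Longrightarrow>
      ((\<lambda>t. u (x + a + t *\<^sub>R axis i 1)) has_real_derivative partial_deriv i u (x + a + t *\<^sub>R axis i 1)) (at t)"
    "((\<lambda>t. partial_deriv i u (x + a + t *\<^sub>R axis i 1))
      has_real_derivative partial_deriv i (partial_deriv i u) (x + a)) (at 0)"
    using C2_on_axis_derivatives[OF u S(1,3)] by blast
  have "0 \<le> partial_deriv i (partial_deriv i u) (x + a) - partial_deriv i (partial_deriv i u) x"
  proof (rule second_derivative_nonneg_at_minimum)
    show "0 < min d d'" using d d' by simp
    show "((\<lambda>t. u (x + a + t *\<^sub>R axis i 1) - u (x + t *\<^sub>R axis i 1)) has_real_derivative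
        partial_deriv i u (x + a + t *\<^sub>R axis i 1) - partial_deriv i u (x + t *\<^sub>R axis i 1)) (at t)"
      if "\<bar>t\<bar> < min d d'" for t
      using that by (intro DERIV_diff d d') auto
    show "((\<lambda>t. partial_deriv i u (x + a + t *\<^sub>R axis i 1) - partial_deriv i u (x + t *\<^sub>R axis i 1))
      has_real_derivative
        partial_deriv i (partial_deriv i u) (x + a) - partial_deriv i (partial_deriv i u) x) (at 0)"
      by (intro DERIV_diff d d')
    show "u (x + a + 0 *\<^sub>R axis i 1) - u (x + 0 *\<^sub>R axis i 1)
        \<le> u (x + a + t *\<^sub>R axis i 1) - u (x + t *\<^sub>R axis i 1)" for t
      using min[of "x + t *\<^sub>R axis i 1"] by (simp add: add_ac)
  qed
  then show "partial_deriv i (partial_deriv i u) x \<le> partial_deriv i (partial_deriv i u) (x + a)"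
    by simp
qed

section \<open>Sliding along an axis\<close>

text \<open>
  Walking from a point of \<open>S\<close> in steps of \<open>v\<close> leaves the bounded set \<open>S\<close> at some step, and the last
  point inside belongs to the set in question.  Hence countably many translates of that set cover \<open>S\<close>,
  which would make the open set \<open>S\<close> negligible if the set were.
\<close>

lemma not_negligible_translation_loss:
  fixes v :: "'a::euclidean_space"
  assumes S: "open S" "bounded S" "S \<noteq> {}" and v: "v \<noteq> 0"
  shows "\<not> negligible {x \<in> S. x + v \<notin> S}" (is "\<not> negligible ?P")
proof
  assume P: "negligible ?P"
  have "S \<subseteq> (\<Union>j. (+) (- (real j *\<^sub>R v)) ` ?P)"
  proof
    fix x assume x: "x \<in> S"
    obtain B where B: "\<And>y. y \<in> S \<Longrightarrow> norm y \<le> B"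
      using S(2) bounded_iff by blast
    obtain N where N: "real N * norm v > B + norm x"
      using v reals_Archimedean3[of "norm v"] zero_less_norm_iff[of v] by blast
    have "x + real N *\<^sub>R v \<notin> S"
    proof
      assume "x + real N *\<^sub>R v \<in> S"
      then have "norm (x + real N *\<^sub>R v) \<le> B" by (rule B)
      moreover have "norm (real N *\<^sub>R v) \<le> norm (x + real N *\<^sub>R v) + norm x"
        using norm_triangle_ineq4[of "x + real N *\<^sub>R v" x] by simp
      ultimately show False using N by simp
    qed
    then have "\<exists>m. (\<forall>i\<le>m. \<not> x + real i *\<^sub>R v \<notin> S) \<and> x + real (Suc m) *\<^sub>R v \<notin> S"
      using x ex_least_nat_less[of "\<lambda>j. x + real j *\<^sub>R v \<notin> S" N] by auto
    then obtain j where j: "x + real j *\<^sub>R v \<in> S" "x + real (Suc j) *\<^sub>R v \<notin> S"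
      by auto
    then have "x + real j *\<^sub>R v \<in> ?P" by (simp add: algebra_simps)
    then show "x \<in> (\<Union>j. (+) (- (real j *\<^sub>R v)) ` ?P)"
      by (intro UN_I[of j] image_eqI[of _ _ "x + real j *\<^sub>R v"]) auto
  qed
  moreover have "negligible (\<Union>j. (+) (- (real j *\<^sub>R v)) ` ?P)"
    using P by (intro negligible_Union_nat negligible_translation)
  ultimately have "negligible S" by (rule negligible_subset[rotated])
  then show False using open_not_negligible[OF S(1,3)] by simp
qed

text \<open>
  Subtract the equations at \<open>x + a\<close> and \<open>x\<close>.  At a minimum of the increment \<open>u (y + a) - u y\<close> the
  local operator has the favourable sign, and the Lipschitz bound leaves a right-hand side
  proportional to the depth of the minimum.
\<close>

lemma nn_integral_kernel_of_shift_at_minimum: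
  fixes u :: "real ^ 'n \<Rightarrow> real"
  assumes s: "0 < s" "s < 1" and S: "open S" "x \<in> S" "x + a \<in> S"
    and g: "L-lipschitz_on UNIV g"
    and u: "u \<in> L2s_space s" "C2_on S u"
    and eq: "\<forall>x\<in>S. \<exists>l. has_fractional_laplacian s u x l \<and> l - laplacian u x = g (u x)"
    and min: "\<And>y. u (x + a) - u x \<le> u (y + a) - u y"
    and nonpos: "u (x + a) \<le> u x"
  shows "(\<integral>\<^sup>+y. ennreal (- frac_kernel s (\<lambda>y. u (y + a) - u y) x y) \<partial>lebesgue)
    \<le> ennreal (L * (u x - u (x + a)) / frac_lap_const TYPE('n) s)"
proof -
  obtain l where l: "has_fractional_laplacian s u x l" "l - laplacian u x = g (u x)"
    using eq S(2) by blast
  obtain m where m: "has_fractional_laplacian s u (x + a) m"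
    "m - laplacian u (x + a) = g (u (x + a))"
    using eq S(3) by blast
  have int: "set_integrable lebesgue (- ball x \<epsilon>) (frac_kernel s u x)"
    "set_integrable lebesgue (- ball x \<epsilon>) (frac_kernel s (\<lambda>y. u (y + a)) x)" if "0 < \<epsilon>" for \<epsilon>
    using set_integrable_frac_kernel set_integrable_frac_kernel_translation u(1) s(1) that by blast+
  have "has_fractional_laplacian s (\<lambda>y. u (y + a) - u y) x (m - l)"
    by (intro has_fractional_laplacian_diff has_fractional_laplacian_translation u s m l int)
  moreover have "set_integrable lebesgue (- ball x \<epsilon>) (frac_kernel s (\<lambda>y. u (y + a) - u y) x)"
    if "0 < \<epsilon>" for \<epsilon>
    unfolding frac_kernel_diff[abs_def] by (intro set_integral_diff int that)
  ultimately have "(\<integral>\<^sup>+y. ennreal (- frac_kernel s (\<lambda>y. u (y + a) - u y) x y) \<partial>lebesgue)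
      \<le> ennreal (- (m - l) / frac_lap_const TYPE('n) s)"
    using min by (intro nn_integral_frac_kernel_at_minimum s)
  also have "\<dots> \<le> ennreal (L * (u x - u (x + a)) / frac_lap_const TYPE('n) s)"
  proof (intro ennreal_leI divide_right_mono)
    have "laplacian u x \<le> laplacian u (x + a)"
      using u(2) S min by (rule laplacian_le_translate_at_minimum)
    moreover have "g (u x) - g (u (x + a)) \<le> L * (u x - u (x + a))"
      using lipschitz_onD[OF g, of "u x" "u (x + a)"] nonpos by (simp add: dist_real_def)
    ultimately show "- (m - l) \<le> L * (u x - u (x + a))"
      using l(2) m(2) by linarith
  qed (use frac_lap_const_pos[OF s, where 'n = 'n] in \<open>simp add: less_imp_le\<close>)
  finally show ?thesis .
qed

text \<open>
  For \<open>y \<in> P\<close> the kernel integrands stay above a positive number from some index on, because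
  \<open>norm (x j - y)\<close> is bounded.  By Fatou's lemma their lower limit has integral zero, so it vanishes
  almost everywhere, which leaves room only for a negligible \<open>P\<close>.  The limit is taken
  pointwise because the lower bound \<open>c\<close> depends on \<open>y\<close>.
\<close>

lemma negligible_if_kernel_mass_vanishes:
  fixes w :: "nat \<Rightarrow> real ^ 'n \<Rightarrow> real" and x :: "nat \<Rightarrow> real ^ 'n"
  assumes s: "0 < s"
    and meas: "\<And>j. w j \<in> borel_measurable lebesgue"
    and mass: "\<And>j. (\<integral>\<^sup>+y. ennreal (- frac_kernel s (w j) (x j) y) \<partial>lebesgue) \<le> ennreal (b j)"
    and b: "b \<longlonglongrightarrow> 0"
    and nonpos: "\<And>j. w j (x j) \<le> 0"
    and R: "\<And>j y. y \<in> P \<Longrightarrow> norm (x j - y) \<le> R"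
    and gain: "\<And>y. y \<in> P \<Longrightarrow> \<exists>c>0. \<forall>\<^sub>F j in sequentially. c \<le> w j y"
  shows "negligible P"
proof -
  define p where "p = real CARD('n) + 2 * s"
  have p: "p > 0" using s by (simp add: p_def)
  define F where "F j y = ennreal (- frac_kernel s (w j) (x j) y)" for j y
  have F_meas: "F j \<in> borel_measurable lebesgue" for j
  proof -
    have [measurable]: "w j \<in> borel_measurable lebesgue" by (rule meas)
    have [measurable]: "(\<lambda>y. norm (x j - y) powr p) \<in> borel_measurable lebesgue"
      by (rule measurable_completion) measurable
    show ?thesis unfolding F_def[abs_def] frac_kernel_def p_def[symmetric] by measurable
  qed
  have "(\<integral>\<^sup>+y. liminf (\<lambda>j. F j y) \<partial>lebesgue) \<le> liminf (\<lambda>j. \<integral>\<^sup>+y. F j y \<partial>lebesgue)"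
    by (intro nn_integral_liminf F_meas)
  also have "\<dots> \<le> liminf (\<lambda>j. ennreal (b j))"
    unfolding F_def by (intro Liminf_mono always_eventually allI mass)
  also have "\<dots> = ennreal 0"
    by (intro lim_imp_Liminf tendsto_ennrealI b) simp
  finally have "(\<integral>\<^sup>+y. liminf (\<lambda>j. F j y) \<partial>lebesgue) = 0" by simp
  then have "AE y in lebesgue. liminf (\<lambda>j. F j y) = 0"
    by (subst (asm) nn_integral_0_iff_AE) (intro borel_measurable_liminf F_meas)
  moreover have "liminf (\<lambda>j. F j y) \<noteq> 0" if y: "y \<in> P" for y
  proof -
    obtain c where c: "c > 0" "\<forall>\<^sub>F j in sequentially. c \<le> w j y" using gain[OF y] by blast
    let ?R = "max R 1"
    have "\<forall>\<^sub>F j in sequentially. ennreal (c / ?R powr p) \<le> F j y"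
      using c(2)
    proof eventually_elim
      case (elim j)
      \<comment> \<open>At \<open>x j\<close> the function is nonpositive, so \<open>y\<close> is off the diagonal and the division is genuine.\<close>
      have "y \<noteq> x j" using elim c(1) nonpos[of j] by auto
      then have "0 < norm (x j - y) powr p" by simp
      moreover have "norm (x j - y) powr p \<le> ?R powr p"
        using R[OF y, of j] p by (intro powr_mono2) auto
      ultimately have "c / ?R powr p \<le> (w j y - w j (x j)) / norm (x j - y) powr p"
        using elim c(1) nonpos[of j] by (intro frac_le) auto
      also have "\<dots> = - frac_kernel s (w j) (x j) y"
        by (simp add: frac_kernel_def p_def minus_divide_left)
      finally show ?case unfolding F_def by (rule ennreal_leI)
    qed
    then have "ennreal (c / ?R powr p) \<le> liminf (\<lambda>j. F j y)" by (rule Liminf_bounded)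
    moreover have "0 < ennreal (c / ?R powr p)" using c(1) by simp
    ultimately show ?thesis by auto
  qed
  ultimately have "AE y in lebesgue. y \<notin> P" by (auto elim!: eventually_mono)
  then obtain N where "N \<in> null_sets lebesgue" "P \<subseteq> N"
    by (auto simp: eventually_ae_filter)
  then show ?thesis
    by (meson negligible_iff_null_sets negligible_subset)
qed

text \<open>
  Far away on either side of the line all points are outside the bounded set, so such a point can
  serve as the third point that the exterior condition asks for.
\<close>

lemma exterior_monotone:
  fixes u \<eta> :: "real ^ 'n \<Rightarrow> real"
  assumes bounded: "bounded \<Omega>"
    and exterior: "\<forall>x\<in>- \<Omega>. u x = \<eta> x"
    and cond:
      "\<forall>x y z. same_line k x y \<and> same_line k x z \<and> y $ k < x $ k \<and> x $ k < z $ k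
          \<and> y \<in> - \<Omega> \<and> z \<in> - \<Omega> \<longrightarrow>
        (x \<in> \<Omega> \<longrightarrow> \<eta> y < u x \<and> u x < \<eta> z) \<and>
        (x \<in> - \<Omega> \<longrightarrow> \<eta> y \<le> \<eta> x \<and> \<eta> x \<le> \<eta> z)"
    and t: "0 < t"
  shows "x \<notin> \<Omega> \<or> x + t *\<^sub>R axis k 1 \<notin> \<Omega> \<Longrightarrow> u x \<le> u (x + t *\<^sub>R axis k 1)"
    and "x \<in> \<Omega> \<Longrightarrow> x + t *\<^sub>R axis k 1 \<notin> \<Omega> \<Longrightarrow> u x < u (x + t *\<^sub>R axis k 1)"
proof -
  let ?e = "axis k 1 :: real ^ 'n"
  obtain B where B: "\<And>y. y \<in> \<Omega> \<Longrightarrow> norm y \<le> B"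
    using bounded bounded_iff by blast
  have far: "y + r *\<^sub>R ?e \<notin> \<Omega>" if "\<bar>r\<bar> > B + norm y" for y r
  proof
    assume "y + r *\<^sub>R ?e \<in> \<Omega>"
    then have "norm (y + r *\<^sub>R ?e) \<le> B" by (rule B)
    moreover have "norm (r *\<^sub>R ?e) \<le> norm (y + r *\<^sub>R ?e) + norm y"
      using norm_triangle_ineq4[of "y + r *\<^sub>R ?e" y] by simp
    ultimately show False using that by simp
  qed
  have line: "same_line k (y + q *\<^sub>R ?e) (y + r *\<^sub>R ?e)" for y q r
    by (simp add: same_line_def axis_def)
  have line_cond: "(y + q *\<^sub>R ?e \<in> \<Omega> \<longrightarrow>
          \<eta> (y + r *\<^sub>R ?e) < u (y + q *\<^sub>R ?e) \<and> u (y + q *\<^sub>R ?e) < \<eta> (y + r' *\<^sub>R ?e)) \<and>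
        (y + q *\<^sub>R ?e \<notin> \<Omega> \<longrightarrow>
          \<eta> (y + r *\<^sub>R ?e) \<le> \<eta> (y + q *\<^sub>R ?e) \<and> \<eta> (y + q *\<^sub>R ?e) \<le> \<eta> (y + r' *\<^sub>R ?e))"
    if "r < q" "q < r'" "y + r *\<^sub>R ?e \<notin> \<Omega>" "y + r' *\<^sub>R ?e \<notin> \<Omega>" for y q r r'
    using cond[rule_format, of "y + q *\<^sub>R ?e" "y + r *\<^sub>R ?e" "y + r' *\<^sub>R ?e"] line that by simp
  \<comment> \<open>Large enough for the points at heights \<open>T\<close> and \<open>- T\<close> over \<open>x\<close> to be outside \<open>\<Omega>\<close>.\<close>
  define T where "T = \<bar>B\<bar> + norm x + t + 1"
  have T: "T > t" "x + T *\<^sub>R ?e \<notin> \<Omega>" "x + (- T) *\<^sub>R ?e \<notin> \<Omega>"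
    using t by (auto simp: T_def intro!: far add_nonneg_pos)
  show strict: "u x < u (x + t *\<^sub>R ?e)" if "x \<in> \<Omega>" "x + t *\<^sub>R ?e \<notin> \<Omega>"
    using line_cond[of "- T" 0 t x] that T t exterior by simp
  show "u x \<le> u (x + t *\<^sub>R ?e)" if "x \<notin> \<Omega> \<or> x + t *\<^sub>R ?e \<notin> \<Omega>"
  proof (cases "x \<in> \<Omega>")
    case True
    then show ?thesis using strict that by simp
  next
    case False
    then show ?thesis
      using line_cond[of 0 t T x] T t exterior by (cases "x + t *\<^sub>R ?e \<in> \<Omega>") auto
  qed
qed

text \<open>
  The increment is continuous on the compact set where both points lie in the closure of \<open>\<Omega>\<close>, and it is
  nonnegative wherever one of them lies outside \<open>\<Omega>\<close>.  A minimum over that compact set is thus a global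
  one, and if it is negative it sits at a pair of points of \<open>\<Omega>\<close>.
\<close>

lemma negative_minimum_of_shift_difference:
  fixes u :: "'a::euclidean_space \<Rightarrow> real"
  assumes bounded: "bounded \<Omega>" and cont: "continuous_on (closure \<Omega>) u"
    and out: "\<And>x. x \<notin> \<Omega> \<or> x + a \<notin> \<Omega> \<Longrightarrow> u x \<le> u (x + a)"
    and neg: "u (z + a) < u z"
  obtains x where "x \<in> \<Omega>" "x + a \<in> \<Omega>" "u (x + a) < u x"
    "\<And>y. u (x + a) - u x \<le> u (y + a) - u y"
proof -
  define K where "K = closure \<Omega> \<inter> (\<lambda>x. x + a) -` closure \<Omega>"
  have "closed ((\<lambda>x. x + a) -` closure \<Omega>)"
    by (intro closed_vimage closed_closure continuous_intros)
  then have K: "compact K"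
    using bounded unfolding K_def by (intro compact_Int_closed) (auto simp: compact_closure)
  have in_K: "y \<in> K" if "u (y + a) < u y" for y
  proof -
    have "y \<in> \<Omega>" "y + a \<in> \<Omega>" using out[of y] that by force+
    then show ?thesis using closure_subset by (auto simp: K_def)
  qed
  have "continuous_on K (\<lambda>x. u (x + a))"
    by (rule continuous_on_compose2[OF cont]) (auto simp: K_def intro!: continuous_intros)
  then have "continuous_on K (\<lambda>x. u (x + a) - u x)"
    by (intro continuous_on_diff continuous_on_subset[OF cont]) (auto simp: K_def)
  then obtain x where x: "x \<in> K" "\<And>y. y \<in> K \<Longrightarrow> u (x + a) - u x \<le> u (y + a) - u y"
    using continuous_attains_inf[OF K] in_K[OF neg] by blast
  show thesis
  proof (rule that)
    show less: "u (x + a) < u x"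
      using x(2)[OF in_K[OF neg]] neg by simp
    then show "x \<in> \<Omega>" "x + a \<in> \<Omega>"
      using out[of x] by force+
    show "u (x + a) - u x \<le> u (y + a) - u y" for y
    proof (cases "y \<in> K")
      case False
      then have "u y \<le> u (y + a)" using in_K[of y] by force
      then show ?thesis using less by simp
    qed (rule x(2))
  qed
qed

text \<open>
  The point is to keep the strict gain across the exit from \<open>\<Omega>\<close> at parameter \<open>\<sigma>\<close> for slightly smaller
  parameters, although \<open>u\<close> may jump outside the closure of \<open>\<Omega>\<close>.  If the line has left \<open>\<Omega>\<close> at some
  parameter \<open>r < \<sigma>\<close>, then the gain at \<open>r\<close> persists by monotonicity from \<open>y + r *\<^sub>R e\<close> upwards.  Otherwise
  \<open>y + \<sigma> *\<^sub>R e\<close> is a boundary point reached from within, and continuity up to the boundary applies.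
\<close>

lemma eventual_gain_before_exit:
  fixes u :: "'a::euclidean_space \<Rightarrow> real"
  assumes cont: "continuous_on (closure \<Omega>) u"
    and out: "\<And>x t. 0 < t \<Longrightarrow> x \<notin> \<Omega> \<or> x + t *\<^sub>R e \<notin> \<Omega> \<Longrightarrow> u x \<le> u (x + t *\<^sub>R e)"
    and strict: "\<And>x t. 0 < t \<Longrightarrow> x \<in> \<Omega> \<Longrightarrow> x + t *\<^sub>R e \<notin> \<Omega> \<Longrightarrow> u x < u (x + t *\<^sub>R e)"
    and \<sigma>: "0 < \<sigma>" and y: "y \<in> \<Omega>" "y + \<sigma> *\<^sub>R e \<notin> \<Omega>"
    and t: "t \<longlonglongrightarrow> \<sigma>" "\<And>j. 0 < t j" "\<And>j. t j < \<sigma>"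
  shows "\<exists>c>0. \<forall>\<^sub>F j in sequentially. c \<le> u (y + t j *\<^sub>R e) - u y"
proof (cases "\<exists>r. 0 < r \<and> r < \<sigma> \<and> y + r *\<^sub>R e \<notin> \<Omega>")
  case True
  then obtain r where r: "0 < r" "r < \<sigma>" "y + r *\<^sub>R e \<notin> \<Omega>" by blast
  have "\<forall>\<^sub>F j in sequentially. r < t j" using order_tendstoD(1)[OF t(1) r(2)] .
  then have "\<forall>\<^sub>F j in sequentially. u (y + r *\<^sub>R e) - u y \<le> u (y + t j *\<^sub>R e) - u y"
  proof eventually_elim
    case (elim j)
    then show ?case
      using out[of "t j - r" "y + r *\<^sub>R e"] r(3) by (simp add: scaleR_left_diff_distrib)
  qed
  moreover have "0 < u (y + r *\<^sub>R e) - u y" using strict[OF r(1) y(1) r(3)] by simp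
  ultimately show ?thesis by blast
next
  case False
  then have "y + t j *\<^sub>R e \<in> \<Omega>" for j using t(2,3) by blast
  then have mem: "y + t j *\<^sub>R e \<in> closure \<Omega>" for j using closure_subset by blast
  have lim: "(\<lambda>j. y + t j *\<^sub>R e) \<longlonglongrightarrow> y + \<sigma> *\<^sub>R e" by (intro tendsto_intros t)
  have "y + \<sigma> *\<^sub>R e \<in> closure \<Omega>"
    using closed_sequentially[OF closed_closure mem lim] .
  then have "(\<lambda>j. u (y + t j *\<^sub>R e)) \<longlonglongrightarrow> u (y + \<sigma> *\<^sub>R e)"
    using continuous_on_tendsto_compose[OF cont lim] mem by simp
  then have ulim: "(\<lambda>j. u (y + t j *\<^sub>R e) - u y) \<longlonglongrightarrow> u (y + \<sigma> *\<^sub>R e) - u y"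
    by (intro tendsto_intros)
  define c where "c = (u (y + \<sigma> *\<^sub>R e) - u y) / 2"
  have c: "0 < c" "c < u (y + \<sigma> *\<^sub>R e) - u y"
    using strict[OF \<sigma> y] by (auto simp: c_def)
  have "\<forall>\<^sub>F j in sequentially. c \<le> u (y + t j *\<^sub>R e) - u y"
    using order_tendstoD(1)[OF ulim c(2)] by (auto elim: eventually_mono)
  with c(1) show ?thesis by blast
qed

theorem theorem1p2:
  fixes s :: real
    and \<Omega> :: "(real ^ 'n) set"
    and k :: 'n
    and g :: "real \<Rightarrow> real"
    and \<eta> u :: "real ^ 'n \<Rightarrow> real"
  assumes s: "0 < s" "s < 1"
    and domain: "open \<Omega>" "connected \<Omega>" "\<Omega> \<noteq> {}" "bounded \<Omega>"
    and convex: "convex_in_direction k \<Omega>"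
    and g: "\<exists>L. L-lipschitz_on UNIV g"
    and u_L2s: "u \<in> L2s_space s"
    and u_C2: "C2_on \<Omega> u"
    and u_boundary: "continuous_on (closure \<Omega>) u"
    and equation:
      "\<forall>x\<in>\<Omega>. \<exists>l. has_fractional_laplacian s u x l \<and> l - laplacian u x = g (u x)"
    and exterior: "\<forall>x\<in>- \<Omega>. u x = \<eta> x"
    and exterior_condition:
      "\<forall>x y z. same_line k x y \<and> same_line k x z \<and> y $ k < x $ k \<and> x $ k < z $ k
          \<and> y \<in> - \<Omega> \<and> z \<in> - \<Omega> \<longrightarrow>
        (x \<in> \<Omega> \<longrightarrow> \<eta> y < u x \<and> u x < \<eta> z) \<and>
        (x \<in> - \<Omega> \<longrightarrow> \<eta> y \<le> \<eta> x \<and> \<eta> x \<le> \<eta> z)"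
  shows "\<forall>x \<tau>. \<tau> > 0 \<and> x \<in> \<Omega> \<and> x + \<tau> *\<^sub>R axis k 1 \<in> \<Omega> \<longrightarrow>
           u (x + \<tau> *\<^sub>R axis k 1) > u x"
proof -
  let ?e = "axis k 1 :: real ^ 'n"
  let ?P = "\<lambda>t. {x \<in> \<Omega>. x + t *\<^sub>R ?e \<notin> \<Omega>}"
  obtain L where L: "L-lipschitz_on UNIV g" using g by blast
  define K where "K = L / frac_lap_const TYPE('n) s"
  obtain B where B: "\<And>y. y \<in> \<Omega> \<Longrightarrow> norm y \<le> B"
    using domain(4) bounded_iff by blast
  have R: "norm (x - y) \<le> 2 * B" if "x \<in> \<Omega>" "y \<in> \<Omega>" for x y
    using norm_triangle_ineq4[of x y] B[OF that(1)] B[OF that(2)] by simp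
  have out: "u x \<le> u (x + t *\<^sub>R ?e)" if "0 < t" "x \<notin> \<Omega> \<or> x + t *\<^sub>R ?e \<notin> \<Omega>" for x t
    using exterior_monotone(1)[OF domain(4) exterior exterior_condition that] .
  have strict: "u x < u (x + t *\<^sub>R ?e)" if "0 < t" "x \<in> \<Omega>" "x + t *\<^sub>R ?e \<notin> \<Omega>" for x t
    using exterior_monotone(2)[OF domain(4) exterior exterior_condition that] .
  have P: "\<not> negligible (?P t)" if "0 < t" for t
    using that by (intro not_negligible_translation_loss domain) auto
  have mass: "(\<integral>\<^sup>+y. ennreal (- frac_kernel s (\<lambda>y. u (y + t *\<^sub>R ?e) - u y) x y) \<partial>lebesgue)
      \<le> ennreal (K * (u x - u (x + t *\<^sub>R ?e)))"
    if "x \<in> \<Omega>" "x + t *\<^sub>R ?e \<in> \<Omega>" "u (x + t *\<^sub>R ?e) \<le> u x"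
      "\<And>y. u (x + t *\<^sub>R ?e) - u x \<le> u (y + t *\<^sub>R ?e) - u y" for x t
    using nn_integral_kernel_of_shift_at_minimum[OF s domain(1) that(1,2) L u_L2s u_C2 equation that(4,3)]
    by (simp add: K_def)
  have [measurable]: "u \<in> borel_measurable lebesgue"
    using u_L2s by (rule L2s_space_borel_measurable)
  have meas: "(\<lambda>y. u (y + a) - u y) \<in> borel_measurable lebesgue" for a
    using measurable_compose[OF measurable_lebesgue_translation[of a], of u borel] by measurable

  have nonneg: "u x \<le> u (x + t *\<^sub>R ?e)" if "0 < t" for x t
  proof (rule ccontr)
    \<comment> \<open>\<open>\<sigma>\<close> is the last shift at which the comparison may fail.\<close>
    define A where "A = {t. 0 < t \<and> (\<exists>x. u (x + t *\<^sub>R ?e) < u x)}"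
    define \<sigma> where "\<sigma> = Sup A"
    assume "\<not> u x \<le> u (x + t *\<^sub>R ?e)"
    then have A: "t \<in> A" using that unfolding A_def not_le by blast
    have min: "\<exists>x. x \<in> \<Omega> \<and> x + r *\<^sub>R ?e \<in> \<Omega> \<and> u (x + r *\<^sub>R ?e) < u x \<and>
        (\<forall>y. u (x + r *\<^sub>R ?e) - u x \<le> u (y + r *\<^sub>R ?e) - u y)" if "r \<in> A" for r
    proof -
      obtain z where "0 < r" "u (z + r *\<^sub>R ?e) < u z" using \<open>r \<in> A\<close> by (auto simp: A_def)
      then show ?thesis
        using negative_minimum_of_shift_difference[OF domain(4) u_boundary, of "r *\<^sub>R ?e" z] out
        by metis
    qed
    have bdd: "bdd_above A"
    proof (rule bdd_aboveI)
      fix r assume r: "r \<in> A"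
      then obtain x where "x \<in> \<Omega>" "x + r *\<^sub>R ?e \<in> \<Omega>" using min by blast
      then have "\<bar>r\<bar> \<le> 2 * B" using R[of "x + r *\<^sub>R ?e" x] by simp
      then show "r \<le> 2 * B" by simp
    qed
    have \<sigma>_upper: "r \<le> \<sigma>" if "r \<in> A" for r
      unfolding \<sigma>_def using that bdd by (rule cSup_upper)
    have \<sigma>: "0 < \<sigma>" using \<sigma>_upper[OF A] \<open>0 < t\<close> by simp
    obtain \<tau> where \<tau>: "\<And>j. \<tau> j \<in> A" "\<tau> \<longlonglongrightarrow> \<sigma>"
      using closure_contains_Sup[OF _ bdd] A unfolding \<sigma>_def closure_sequential by blast
    \<comment> \<open>At \<open>\<sigma>\<close> itself the comparison holds, as a limit of larger shifts; hence \<open>\<tau> j < \<sigma>\<close>.\<close>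
    have \<sigma>_nonneg: "u x \<le> u (x + \<sigma> *\<^sub>R ?e)" for x
    proof (cases "x \<in> \<Omega> \<and> x + \<sigma> *\<^sub>R ?e \<in> \<Omega>")
      case True
      have above: "u x \<le> u (x + r *\<^sub>R ?e)" if "\<sigma> < r" for r
      proof (rule ccontr)
        assume "\<not> u x \<le> u (x + r *\<^sub>R ?e)"
        then have "r \<in> A" using that \<sigma> unfolding A_def not_le by force
        then show False using \<sigma>_upper that by fastforce
      qed
      have "isCont u (x + \<sigma> *\<^sub>R ?e)"
        using u_C2 True domain(1) unfolding C2_on_def C1_on_def
        by (simp add: continuous_on_eq_continuous_at)
      moreover have "((\<lambda>r. x + r *\<^sub>R ?e) \<longlongrightarrow> x + \<sigma> *\<^sub>R ?e) (at_right \<sigma>)"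
        by (intro tendsto_intros)
      ultimately have "((\<lambda>r. u (x + r *\<^sub>R ?e)) \<longlongrightarrow> u (x + \<sigma> *\<^sub>R ?e)) (at_right \<sigma>)"
        by (rule isCont_tendsto_compose)
      then show ?thesis
        by (rule tendsto_lowerbound)
          (auto intro: above eventually_mono[OF eventually_at_right_less[of \<sigma>]])
    qed (use out[OF \<sigma>] in blast)
    have \<tau>_bounds: "0 < \<tau> j" "\<tau> j < \<sigma>" for j
    proof -
      have "\<sigma> \<notin> A" using \<sigma>_nonneg leD unfolding A_def by blast
      then have "\<tau> j \<noteq> \<sigma>" using \<tau>(1)[of j] by auto
      then show "\<tau> j < \<sigma>" using \<sigma>_upper[OF \<tau>(1)[of j]] by simp
      show "0 < \<tau> j" using \<tau>(1)[of j] by (simp add: A_def)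
    qed
    \<comment> \<open>The negative minima at the shifts \<open>\<tau> j\<close>; the next steps show that their depths tend to zero.\<close>
    obtain \<xi> where \<xi>: "\<And>j. \<xi> j \<in> \<Omega>" "\<And>j. \<xi> j + \<tau> j *\<^sub>R ?e \<in> \<Omega>"
      "\<And>j. u (\<xi> j + \<tau> j *\<^sub>R ?e) < u (\<xi> j)"
      "\<And>j y. u (\<xi> j + \<tau> j *\<^sub>R ?e) - u (\<xi> j) \<le> u (y + \<tau> j *\<^sub>R ?e) - u y"
      using min[OF \<tau>(1)] by metis
    have mem: "\<xi> j \<in> closure \<Omega>" "\<xi> j + \<tau> j *\<^sub>R ?e \<in> closure \<Omega>" for j
      using \<xi>(1,2) closure_subset by blast+
    have "seq_compact (closure \<Omega>)"
      using domain(4) by (simp add: compact_closure compact_imp_seq_compact)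
    then obtain \<xi>' \<rho> where \<rho>: "\<xi>' \<in> closure \<Omega>" "strict_mono \<rho>" "(\<xi> \<circ> \<rho>) \<longlonglongrightarrow> \<xi>'"
      using seq_compactE[of "closure \<Omega>" \<xi>] mem(1) by metis
    have \<tau>_lim: "(\<lambda>j. \<tau> (\<rho> j)) \<longlonglongrightarrow> \<sigma>"
      using LIMSEQ_subseq_LIMSEQ[OF \<tau>(2) \<rho>(2)] by (simp add: o_def)
    have \<xi>_lim: "(\<lambda>j. \<xi> (\<rho> j)) \<longlonglongrightarrow> \<xi>'" using \<rho>(3) by (simp add: o_def)
    have shifted_lim: "(\<lambda>j. \<xi> (\<rho> j) + \<tau> (\<rho> j) *\<^sub>R ?e) \<longlonglongrightarrow> \<xi>' + \<sigma> *\<^sub>R ?e"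
      by (intro tendsto_intros \<xi>_lim \<tau>_lim)
    have "\<xi>' + \<sigma> *\<^sub>R ?e \<in> closure \<Omega>"
      using closed_sequentially[OF closed_closure mem(2) shifted_lim] .
    then have "(\<lambda>j. u (\<xi> (\<rho> j) + \<tau> (\<rho> j) *\<^sub>R ?e)) \<longlonglongrightarrow> u (\<xi>' + \<sigma> *\<^sub>R ?e)"
      using continuous_on_tendsto_compose[OF u_boundary shifted_lim] mem by simp
    moreover have "(\<lambda>j. u (\<xi> (\<rho> j))) \<longlonglongrightarrow> u \<xi>'"
      using continuous_on_tendsto_compose[OF u_boundary \<xi>_lim \<rho>(1)] mem by simp
    ultimately have depth: "(\<lambda>j. u (\<xi> (\<rho> j)) - u (\<xi> (\<rho> j) + \<tau> (\<rho> j) *\<^sub>R ?e))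
        \<longlonglongrightarrow> u \<xi>' - u (\<xi>' + \<sigma> *\<^sub>R ?e)"
      by (intro tendsto_diff)
    then have "0 \<le> u \<xi>' - u (\<xi>' + \<sigma> *\<^sub>R ?e)"
      by (rule LIMSEQ_le_const) (use \<xi>(3) in \<open>auto simp: less_imp_le\<close>)
    then have "u \<xi>' - u (\<xi>' + \<sigma> *\<^sub>R ?e) = 0" using \<sigma>_nonneg[of \<xi>'] by simp
    with depth have vanish:
      "(\<lambda>j. K * (u (\<xi> (\<rho> j)) - u (\<xi> (\<rho> j) + \<tau> (\<rho> j) *\<^sub>R ?e))) \<longlonglongrightarrow> 0"
      by (auto intro: tendsto_mult_right_zero)
    \<comment> \<open>The points that exit \<open>\<Omega>\<close> under the shift by \<open>\<sigma>\<close> are too many for such shallow minima.\<close>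
    have "negligible (?P \<sigma>)"
    proof (rule negligible_if_kernel_mass_vanishes
        [where w = "\<lambda>j y. u (y + \<tau> (\<rho> j) *\<^sub>R ?e) - u y" and x = "\<lambda>j. \<xi> (\<rho> j)"])
      show "\<exists>c>0. \<forall>\<^sub>F j in sequentially. c \<le> u (y + \<tau> (\<rho> j) *\<^sub>R ?e) - u y" if "y \<in> ?P \<sigma>" for y
        using that by (intro eventual_gain_before_exit[OF u_boundary out strict \<sigma> _ _ \<tau>_lim \<tau>_bounds]) auto
      show "norm (\<xi> (\<rho> j) - y) \<le> 2 * B" if "y \<in> ?P \<sigma>" for j y
        using that R \<xi>(1) by blast
      show "u (\<xi> (\<rho> j) + \<tau> (\<rho> j) *\<^sub>R ?e) - u (\<xi> (\<rho> j)) \<le> 0" for j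
        using \<xi>(3)[of "\<rho> j"] by simp
    qed (use s meas vanish in \<open>auto intro!: mass \<xi>(1,2,4) less_imp_le[OF \<xi>(3)]\<close>)
    with P[OF \<sigma>] show False ..
  qed

  show ?thesis
  proof (intro allI impI, elim conjE, rule ccontr)
    fix x \<tau>
    assume \<tau>: "0 < \<tau>" and x: "x \<in> \<Omega>" "x + \<tau> *\<^sub>R ?e \<in> \<Omega>"
      and not_less: "\<not> u x < u (x + \<tau> *\<^sub>R ?e)"
    have touch: "u (x + \<tau> *\<^sub>R ?e) = u x" using nonneg[OF \<tau>, of x] not_less by simp
    \<comment> \<open>A point of equality is a minimum of depth zero, so the whole kernel integral vanishes there.\<close>
    have "negligible (?P \<tau>)"
    proof (rule negligible_if_kernel_mass_vanishes
        [where w = "\<lambda>_ y. u (y + \<tau> *\<^sub>R ?e) - u y" and x = "\<lambda>_. x" and b = "\<lambda>_. 0"])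
      show "(\<integral>\<^sup>+y. ennreal (- frac_kernel s (\<lambda>y. u (y + \<tau> *\<^sub>R ?e) - u y) x y) \<partial>lebesgue)
          \<le> ennreal 0"
        using mass[OF x] touch nonneg[OF \<tau>] by simp
      show "\<exists>c>0. \<forall>\<^sub>F j in sequentially. c \<le> u (y + \<tau> *\<^sub>R ?e) - u y" if "y \<in> ?P \<tau>" for y
        using that strict[OF \<tau>, of y] by (intro exI[of _ "u (y + \<tau> *\<^sub>R ?e) - u y"]) auto
      show "norm (x - y) \<le> 2 * B" if "y \<in> ?P \<tau>" for y
        using that R x(1) by blast
    qed (use s meas touch in auto)
    with P[OF \<tau>] show False ..
  qed
qed

end
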